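(* Let $G = \langle V, E\rangle$ be a finite, loopless, strongly connected digraph with positive real edge weights $w(u,v)$ for $(u,v)\in E$. Let $\mathcal{B}$ be the set of formal convex combinations of elements of $V$, and let $\equiv$ be a color equivalence on $\mathcal{B}$. If $G$ is chromonic with respect to $\equiv$, then all vertices of $G$ have the same color; that is, $u \equiv v$ for all $u, v \in V$.
   Context: Digraph conventions: $V$ is a finite set of vertices and $E$ is a set of ordered pairs $(u,v)$ of distinct vertices (edges from $u$ to $v$; no loops). Each edge $(u,v)$ carries a positive real weight $w(u,v)$. The out-neighbors of $u$ are the vertices $v$ with $(u,v)\in E$. $G$ is strongly connected if for any two vertices $u$ and $v$ there is a directed path from $u$ to $v$. Blends: $\mathcal{B}$ denotes the set of formal convex combinations ("blends") of the elements of $V$, i.e. formal sums $\sum_{v\in V} a_v v$ with real $a_v \ge 0$ and $\sum_{v \in V} a_v = 1$ (equivalently, the standard simplex in $\mathbb{R}^V$), with convex combinations of elements of $\mathcal{B}$ taken coefficientwise. $V$ is regarded as a subset of $\mathcal{B}$ by identifying $v$ with the blend having coefficient $1$ at $v$. Color equivalence: an equivalence relation $\equiv$ on $\mathcal{B}$ is called a color equivalence if it respects convex combination, that is, for all $x,y,z,w\in\mathcal{B}$ and all $p,q\in[0,1]$, $$px+(1-p)y\equiv z \implies q\bigl(px+(1-p)y\bigr)+(1-q)w\equiv qz+(1-q)w.$$ (Here $w$ is an element of $\mathcal{B}$, not the weight function. No continuity or closedness of $\equiv$ is assumed.) The color of a blend $b\in\mathcal{B}$ is its equivalence class $C(b)$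 under $\equiv$; in particular the color of a vertex $v$ is $C(v)$. Chromonic: $G$ is chromonic (with respect to $\equiv$) if for each $u\in V$, with out-neighbors $v_1,\dots,v_k$, $$u\equiv \frac{1}{\sum_{i=1}^k w(u,v_i)}\left(\sum_{i=1}^k w(u,v_i)\,v_i\right).$$ *)

theory Defs
  imports
    Complex_Main
    "Graph_Theory.Digraph_Component"
    "Graph_Theory.Pair_Digraph"
begin

text \<open>
  A blend is encoded by its coefficient function. The coefficients are required to vanish
  outside \<open>V\<close>, so that two blends are equal exactly if their coefficients on \<open>V\<close> agree.
\<close>

definition blends :: "'a set \<Rightarrow> ('a \<Rightarrow> real) set" where
  "blends V = {a. (\<forall>v\<in>V. a v \<ge> 0) \<and> (\<forall>v. v \<notin> V \<longrightarrow> a v = 0) \<and> (\<Sum>v\<in>V. a v) = 1}"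

definition vertex_blend :: "'a \<Rightarrow> 'a \<Rightarrow> real" where
  "vertex_blend v = (\<lambda>x. if x = v then 1 else 0)"

definition mix :: "real \<Rightarrow> ('a \<Rightarrow> real) \<Rightarrow> ('a \<Rightarrow> real) \<Rightarrow> 'a \<Rightarrow> real" where
  "mix p x y = (\<lambda>v. p * x v + (1 - p) * y v)"

definition color_equivalence :: "'a set \<Rightarrow> ('a \<Rightarrow> real) rel \<Rightarrow> bool" where
  "color_equivalence V R \<longleftrightarrow>
     equiv (blends V) R \<and>
     (\<forall>x\<in>blends V. \<forall>y\<in>blends V. \<forall>z\<in>blends V. \<forall>w\<in>blends V. \<forall>p\<in>{0..1}. \<forall>q\<in>{0..1}.
        (mix p x y, z) \<in> R \<longrightarrow> (mix q (mix p x y) w, mix q z w) \<in> R)"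

definition color :: "('a \<Rightarrow> real) rel \<Rightarrow> ('a \<Rightarrow> real) \<Rightarrow> ('a \<Rightarrow> real) set" where
  "color R b = R `` {b}"

definition out_neighbors :: "'a pair_pre_digraph \<Rightarrow> 'a \<Rightarrow> 'a set" where
  "out_neighbors G u = {v. (u, v) \<in> parcs G}"

definition out_blend :: "'a pair_pre_digraph \<Rightarrow> ('a \<times> 'a \<Rightarrow> real) \<Rightarrow> 'a \<Rightarrow> 'a \<Rightarrow> real" where
  "out_blend G w u =
     (\<lambda>x. 1 / (\<Sum>v\<in>out_neighbors G u. w (u, v)) *
          (\<Sum>v\<in>out_neighbors G u. w (u, v) * vertex_blend v x))"

text \<open>
  The weighted average of the out-neighbors is undefined for a vertex without out-neighbors,
  so no condition is imposed there. In a strongly connected loopless digraph such a vertex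
  occurs only if it is the only vertex.
\<close>

definition chromonic ::
    "'a pair_pre_digraph \<Rightarrow> ('a \<times> 'a \<Rightarrow> real) \<Rightarrow> ('a \<Rightarrow> real) rel \<Rightarrow> bool" where
  "chromonic G w R \<longleftrightarrow>
     (\<forall>u\<in>pverts G. out_neighbors G u \<noteq> {} \<longrightarrow> (vertex_blend u, out_blend G w u) \<in> R)"

lemma vertex_blend_in_blends:
  assumes "finite V" "v \<in> V"
  shows "vertex_blend v \<in> blends V"
  using assms by (auto simp: blends_def vertex_blend_def)

lemma mix_in_blends:
  assumes "x \<in> blends V" "y \<in> blends V" "p \<in> {0..1}"
  shows "mix p x y \<in> blends V"
  using assms by (auto simp: blends_def mix_def sum.distrib simp flip: sum_distrib_left)

lemma out_blend_in_blends:
  assumes "pair_digraph G" and pos: "\<forall>e\<in>parcs G. w e > 0" and ne: "out_neighbors G u \<noteq> {}"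
  shows "out_blend G w u \<in> blends (pverts G)"
proof -
  interpret pair_digraph G by fact
  let ?N = "out_neighbors G u"
  have sub: "?N \<subseteq> pverts G"
    by (auto simp: out_neighbors_def dest: in_arcsD2)
  have fin: "finite (pverts G)" "finite ?N"
    using pair_finite_verts sub by (auto intro: finite_subset)
  have wpos: "w (u, v) > 0" if "v \<in> ?N" for v
    using pos that by (auto simp: out_neighbors_def)
  have S: "(\<Sum>v\<in>?N. w (u, v)) > 0"
    using fin ne wpos by (intro sum_pos) auto
  have "(\<Sum>x\<in>pverts G. \<Sum>v\<in>?N. w (u, v) * vertex_blend v x) = (\<Sum>v\<in>?N. w (u, v))"
  proof (subst sum.swap, rule sum.cong[OF refl])
    fix v assume "v \<in> ?N"
    then have "(\<Sum>x\<in>pverts G. vertex_blend v x) = 1"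
      using vertex_blend_in_blends[OF fin(1), of v] sub by (auto simp: blends_def)
    then show "(\<Sum>x\<in>pverts G. w (u, v) * vertex_blend v x) = w (u, v)"
      by (simp flip: sum_distrib_left)
  qed
  then have "(\<Sum>x\<in>pverts G. out_blend G w u x) = 1"
    using S by (simp add: out_blend_def flip: sum_divide_distrib)
  moreover have "out_blend G w u x \<ge> 0" for x
    unfolding out_blend_def using S wpos
    by (intro mult_nonneg_nonneg sum_nonneg) (auto simp: vertex_blend_def less_imp_le)
  moreover have "out_blend G w u x = 0" if "x \<notin> pverts G" for x
    using that sub by (auto simp: out_blend_def vertex_blend_def intro!: sum.neutral)
  ultimately show ?thesis
    by (auto simp: blends_def)
qed

end

theory Submission
  imports Defs "HOL-Library.Function_Algebras"
begin

text \<open>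
  The multiples \<open>t (y - x)\<close> of differences of equivalent blends form a linear subspace \<open>D\<close>.
  If two blends with full support differ by an element \<open>t (y - x)\<close> of \<open>D\<close>, then one can walk
  from the first to the second in steps so small that each of them just replaces a small
  portion of \<open>x\<close> by the same portion of \<open>y\<close>; hence the two blends are equivalent.
  A linear functional that vanishes on \<open>D\<close> is harmonic on the vertices, so it is constant
  there by the maximum principle; hence \<open>D\<close> contains the difference of any two blends.
  Finally, moving along edges shows that every vertex is equivalent to a blend with full support.
\<close>

section \<open>Separation of a point from a subspace by a linear functional\<close>

text \<open>A basis of \<open>S\<close> stays independent when \<open>d\<close> is added, so values
  0 on the basis and \<open>c\<close> at \<open>d\<close> can be prescribed and extended
  linearly.\<close>

lemma (in vector_space_pair) linear_functional_vanishing_on_subspace: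
  assumes S: "vs1.subspace S" and d: "d \<notin> S"
  obtains g where "Vector_Spaces.linear s1 s2 g" "\<And>x. x \<in> S \<Longrightarrow> g x = 0" "g d = c"
proof -
  obtain B where B: "B \<subseteq> S" "vs1.independent B" "S \<subseteq> vs1.span B"
    by (rule vs1.maximal_independent_subset)
  have "vs1.span B = S"
    using B S by (simp add: vs1.span_subspace)
  then have "vs1.independent (insert d B)"
    using B(2) d by (simp add: vs1.independent_insertI)
  then obtain g where g: "Vector_Spaces.linear s1 s2 g"
      and gB: "\<forall>x\<in>insert d B. g x = (if x = d then c else 0)"
    using linear_independent_extend[of "insert d B" "\<lambda>x. if x = d then c else 0"] by blast
  have g0: "g x = 0" if "x \<in> S" for x
  proof (rule linear_eq_0_on_span[OF g])
    show "x \<in> vs1.span B"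
      using that B(3) by blast
    show "g b = 0" if "b \<in> B" for b
      using that gB B(1) d by (auto split: if_splits)
  qed
  have "g d = c"
    using gB by simp
  with g g0 show ?thesis
    by (rule that)
qed

text \<open>The scaling that, with pointwise addition, makes real functions a vector space, so that
  linear functionals on them can be separated from subspaces.\<close>

definition fun_scale :: "real \<Rightarrow> ('a \<Rightarrow> real) \<Rightarrow> 'a \<Rightarrow> real" where
  "fun_scale c f = (\<lambda>x. c * f x)"

interpretation fun_real: vector_space_pair fun_scale "(*) :: real \<Rightarrow> real \<Rightarrow> real"
  by unfold_locales (auto simp: fun_scale_def fun_eq_iff algebra_simps)

section \<open>Color equivalences\<close>

lemma color_equivalence_equiv:
  "color_equivalence V R \<Longrightarrow> equiv (blends V) R"
  by (simp add: color_equivalence_def)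

lemma color_equivalence_refl:
  "color_equivalence V R \<Longrightarrow> x \<in> blends V \<Longrightarrow> (x, x) \<in> R"
  by (meson color_equivalence_equiv equivE refl_onD)

lemma color_equivalence_sym:
  "color_equivalence V R \<Longrightarrow> (x, y) \<in> R \<Longrightarrow> (y, x) \<in> R"
  by (meson color_equivalence_equiv equivE symD)

lemma color_equivalence_trans:
  "color_equivalence V R \<Longrightarrow> (x, y) \<in> R \<Longrightarrow> (y, z) \<in> R \<Longrightarrow> (x, z) \<in> R"
  by (meson color_equivalence_equiv equivE transD)

lemma color_equivalence_blends:
  "color_equivalence V R \<Longrightarrow> (x, y) \<in> R \<Longrightarrow> x \<in> blends V \<and> y \<in> blends V"
  by (meson color_equivalence_equiv equiv_class_eq_iff)

lemma mix_self: "mix p x x = x"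
  by (auto simp: mix_def algebra_simps)

lemma mix_commute: "mix p x y = mix (1 - p) y x"
  by (auto simp: mix_def)

text \<open>First \<open>x\<close> is exchanged for \<open>y\<close> with \<open>z\<close> kept,
  then \<open>z\<close> for \<open>w\<close> with \<open>y\<close> kept.\<close>

lemma color_equivalence_mix:
  assumes R: "color_equivalence V R" and xy: "(x, y) \<in> R" and zw: "(z, w) \<in> R"
    and p: "p \<in> {0..1}"
  shows "(mix p x z, mix p y w) \<in> R"
proof -
  \<comment> \<open>The defining condition speaks of a mixture on the left of the premise;
    \<open>x'\<close> is read as \<open>mix 1 x' x'\<close>.\<close>
  have left: "(mix q x' z', mix q y' z') \<in> R"
    if "(x', y') \<in> R" "z' \<in> blends V" "q \<in> {0..1}" for x' y' z' q
    using R color_equivalence_blends[OF R that(1)] that mix_self[of 1 x']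
    unfolding color_equivalence_def by (metis atLeastAtMost_iff order_refl zero_le_one)
  have "(mix p x z, mix p y z) \<in> R"
    using left xy p color_equivalence_blends[OF R zw] by blast
  moreover have "(mix p y z, mix p y w) \<in> R"
    using left[OF zw, of y "1 - p"] p color_equivalence_blends[OF R xy]
    by (simp add: mix_commute[of p])
  ultimately show ?thesis
    by (rule color_equivalence_trans[OF R])
qed

text \<open>What remains of \<open>a\<close> after removing \<open>s\<close> times \<open>x\<close>
  is nonnegative with total \<open>1 - s\<close>; rescaling it gives the blend
  \<open>z\<close>.\<close>

lemma split_off_blend:
  assumes V: "finite V" and a: "a \<in> blends V" and x: "x \<in> blends V"
    and s: "0 \<le> s" "s < 1" and le: "\<And>v. v \<in> V \<Longrightarrow> s * x v \<le> a v"
  obtains z where "z \<in> blends V" "a = mix s x z"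
proof
  let ?z = "\<lambda>v. (a v - s * x v) / (1 - s)"
  have "(\<Sum>v\<in>V. ?z v) = ((\<Sum>v\<in>V. a v) - s * (\<Sum>v\<in>V. x v)) / (1 - s)"
    by (simp add: sum_subtractf sum_distrib_left flip: sum_divide_distrib)
  then show "?z \<in> blends V"
    using a x s le by (auto simp: blends_def)
  show "a = mix s x ?z"
    using s by (auto simp: mix_def)
qed

text \<open>Coefficients of \<open>x\<close> are at most 1, so \<open>a\<close> contains the portion
  \<open>s\<close> of \<open>x\<close>. Exchanging this portion for the same portion of
  \<open>y\<close> adds \<open>s\<close> times \<open>y - x\<close>.\<close>

lemma color_equivalence_small_step:
  assumes R: "color_equivalence V R" and V: "finite V" and xy: "(x, y) \<in> R"
    and a: "a \<in> blends V" and s: "0 \<le> s" "s < 1"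
    and le: "\<And>v. v \<in> V \<Longrightarrow> s \<le> a v"
  shows "(a, \<lambda>v. a v + s * (y v - x v)) \<in> R"
proof -
  have x: "x \<in> blends V"
    using color_equivalence_blends[OF R xy] by blast
  have "s * x v \<le> a v" if "v \<in> V" for v
  proof -
    have "x v \<le> (\<Sum>v\<in>V. x v)"
      using x V that by (intro member_le_sum) (auto simp: blends_def)
    then have "s * x v \<le> s"
      using x s mult_left_le[of "x v" s] by (simp add: blends_def)
    with le[OF that] show ?thesis
      by simp
  qed
  then obtain z where z: "z \<in> blends V" "a = mix s x z"
    using split_off_blend[OF V a x s] by metis
  have "(mix s x z, mix s y z) \<in> R"
    using color_equivalence_mix[OF R xy color_equivalence_refl[OF R z(1)]] s by simp
  moreover have "mix s y z = (\<lambda>v. a v + s * (y v - x v))"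
    unfolding z(2) by (auto simp: mix_def algebra_simps)
  ultimately show ?thesis
    using z(2) by simp
qed

section \<open>The linear space of color directions\<close>

definition color_directions :: "('a \<Rightarrow> real) rel \<Rightarrow> ('a \<Rightarrow> real) set" where
  "color_directions R = {\<lambda>v. t * (y v - x v) | t x y. t \<ge> 0 \<and> (x, y) \<in> R}"

lemma color_directionsI:
  "t \<ge> 0 \<Longrightarrow> (x, y) \<in> R \<Longrightarrow> (\<And>v. d v = t * (y v - x v)) \<Longrightarrow> d \<in> color_directions R"
  unfolding color_directions_def
  by (rule CollectI, rule exI[of _ t], rule exI[of _ x], rule exI[of _ y]) auto

text \<open>The segment from \<open>a\<close> to \<open>b\<close> stays away from the boundary of
  the simplex, so it can be cut into equal pieces, each of which is a small step along
  \<open>y - x\<close>.\<close>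

lemma full_support_equivalent:
  assumes R: "color_equivalence V R" and V: "finite V" "V \<noteq> {}"
    and a: "a \<in> blends V" "\<And>v. v \<in> V \<Longrightarrow> a v > 0"
    and b: "b \<in> blends V" "\<And>v. v \<in> V \<Longrightarrow> b v > 0"
    and ab: "b - a \<in> color_directions R"
  shows "(a, b) \<in> R"
proof -
  obtain t x y where t: "t \<ge> 0" and xy: "(x, y) \<in> R"
      and diff: "b - a = (\<lambda>v. t * (y v - x v))"
    using ab unfolding color_directions_def by blast
  have b_eq: "b v = a v + t * (y v - x v)" for v
    using fun_cong[OF diff, of v] by simp
  \<comment> \<open>A lower bound for the coefficients at both ends, hence on the whole
    segment.\<close>
  define \<delta> where "\<delta> = Min ((\<lambda>v. min (a v) (b v)) ` V)"
  have \<delta>: "\<delta> > 0"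
    using V a(2) b(2) by (auto simp: \<delta>_def)
  have \<delta>_le: "\<delta> \<le> min (a v) (b v)" if "v \<in> V" for v
    unfolding \<delta>_def using V that by (intro Min_le) auto
  \<comment> \<open>Each of the \<open>N\<close> steps then has size \<open>t / real N\<close>:
    below \<delta>, so that enough of \<open>x\<close> is present, and below 1, so that a remainder
    is left to rescale.\<close>
  obtain N :: nat where N: "t / min \<delta> 1 < real N"
    using reals_Archimedean2 by blast
  have N0: "real N > 0"
    using N t \<delta> by (meson divide_nonneg_pos le_less_trans min_less_iff_conj zero_less_one)
  have "t < real N * min \<delta> 1"
    using N \<delta> by (simp add: pos_divide_less_eq del: min_mult_distrib_left min_mult_distrib_right)
  then have s: "t / real N < min \<delta> 1"
    using pos_divide_less_eq[OF N0, of t "min \<delta> 1"] by (metis mult.commute)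
  \<comment> \<open>The division points of the segment, with \<open>c 0 = a\<close> and
    \<open>c N = b\<close>.\<close>
  define c where "c k = mix (real k / real N) b a" for k
  have c_blend: "c k \<in> blends V" if "k \<le> N" for k
    unfolding c_def using that N0 a b by (intro mix_in_blends) auto
  have "(a, c k) \<in> R" if "k \<le> N" for k
    using that
  proof (induction k)
    case 0
    have "c 0 = a"
      by (simp add: c_def mix_def)
    then show ?case
      using color_equivalence_refl[OF R a(1)] by simp
  next
    case (Suc k)
    have "t / real N \<le> c k v" if "v \<in> V" for v
    proof -
      let ?p = "real k / real N"
      have p: "0 \<le> ?p" "?p \<le> 1"
        using Suc.prems N0 by auto
      have "?p * \<delta> + (1 - ?p) * \<delta> \<le> c k v"
        unfolding c_def mix_def using p \<delta>_le[OF that] by (intro add_mono mult_left_mono) auto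
      then show ?thesis
        using s by (simp add: algebra_simps)
    qed
    then have "(c k, \<lambda>v. c k v + t / real N * (y v - x v)) \<in> R"
      using Suc.prems s t N0 c_blend[of k]
      by (intro color_equivalence_small_step[OF R V(1) xy]) auto
    moreover have "(\<lambda>v. c k v + t / real N * (y v - x v)) = c (Suc k)"
    proof
      fix v
      have "c (Suc k) v = c k v + (b v - a v) / real N"
        unfolding c_def mix_def by (simp add: add_divide_distrib diff_divide_distrib algebra_simps)
      then show "c k v + t / real N * (y v - x v) = c (Suc k) v"
        using b_eq[of v] by simp
    qed
    ultimately have "(c k, c (Suc k)) \<in> R"
      by simp
    with Suc show ?case
      by (intro color_equivalence_trans[OF R, of a "c k" "c (Suc k)"]) auto
  qed
  from this[of N] show ?thesis
    using N0 by (simp add: c_def mix_def)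
qed

text \<open>Sums come from mixing the two equivalences, with weights proportional to the factors
  \<open>t\<close> and \<open>t'\<close>. Symmetry of \<open>R\<close> reverses a direction, so
  nonnegative factors already give all real multiples.\<close>

lemma subspace_color_directions:
  assumes R: "color_equivalence V R" and ne: "R \<noteq> {}"
  shows "fun_real.vs1.subspace (color_directions R)"
proof (rule fun_real.vs1.subspaceI)
  obtain x0 y0 where "(x0, y0) \<in> R"
    using ne by auto
  then show "0 \<in> color_directions R"
    by (intro color_directionsI[of 0 x0 y0]) auto
  show "d + e \<in> color_directions R"
    if d: "d \<in> color_directions R" and e: "e \<in> color_directions R" for d e
  proof -
    obtain t x y where t: "t \<ge> 0" "(x, y) \<in> R" "d = (\<lambda>v. t * (y v - x v))"
      using d unfolding color_directions_def by blast
    obtain t' x' y' where t': "t' \<ge> 0" "(x', y') \<in> R" "e = (\<lambda>v. t' * (y' v - x' v))"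
      using e unfolding color_directions_def by blast
    \<comment> \<open>If both factors are 0, division by zero makes \<open>p\<close> equal to 0, and
      the identities \<open>tp\<close> still hold.\<close>
    define p where "p = t / (t + t')"
    have p: "p \<in> {0..1}"
      using t(1) t'(1) by (auto simp: p_def divide_le_eq)
    have tp: "(t + t') * p = t" "(t + t') * (1 - p) = t'"
    proof -
      show "(t + t') * p = t"
        using t(1) t'(1) by (cases "t + t' = 0") (auto simp: p_def)
      then show "(t + t') * (1 - p) = t'"
        by (simp add: right_diff_distrib)
    qed
    show ?thesis
    proof (rule color_directionsI)
      show "(mix p x x', mix p y y') \<in> R"
        using color_equivalence_mix[OF R t(2) t'(2) p] .
      fix v
      have "(t + t') * (mix p y y' v - mix p x x' v) =
          ((t + t') * p) * (y v - x v) + ((t + t') * (1 - p)) * (y' v - x' v)"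
        unfolding mix_def by algebra
      then show "(d + e) v = (t + t') * (mix p y y' v - mix p x x' v)"
        using t(3) t'(3) tp by simp
    qed (use t t' in simp)
  qed
  show "fun_scale c d \<in> color_directions R" if d: "d \<in> color_directions R" for c d
  proof -
    obtain t x y where t: "t \<ge> 0" "(x, y) \<in> R" "d = (\<lambda>v. t * (y v - x v))"
      using d unfolding color_directions_def by blast
    show ?thesis
    proof (cases "c \<ge> 0")
      case True
      with t show ?thesis
        by (intro color_directionsI[of "c * t" x y]) (auto simp: fun_scale_def)
    next
      case False
      show ?thesis
      proof (rule color_directionsI)
        show "- c * t \<ge> 0"
          using False t(1) by (intro mult_nonneg_nonneg) auto
        show "(y, x) \<in> R"
          using color_equivalence_sym[OF R t(2)] .
        show "fun_scale c d v = - c * t * (x v - y v)" for v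
          unfolding fun_scale_def t(3) by algebra
      qed
    qed
  qed
qed

section \<open>Chromonic digraphs\<close>

lemma finite_out_neighbors:
  assumes "pair_digraph G"
  shows "finite (out_neighbors G u)"
proof -
  interpret pair_digraph G by fact
  show ?thesis
    by (rule finite_subset[OF _ pair_finite_verts]) (auto simp: out_neighbors_def dest: in_arcsD2)
qed

lemma sum_fun_apply:
  fixes f :: "'i \<Rightarrow> 'a \<Rightarrow> 'b::comm_monoid_add"
  shows "(\<Sum>i\<in>A. f i) x = (\<Sum>i\<in>A. f i x)"
  by (induction A rule: infinite_finite_induct) auto

text \<open>Induction along a path from \<open>u\<close> to \<open>v\<close>. It serves to propagate
  both maximality of a harmonic function and positivity of a coefficient along edges.\<close>

lemma strongly_connected_closed_set:
  assumes sc: "strongly_connected (with_proj G)"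
    and u: "u \<in> pverts G" "u \<in> S"
    and closed: "\<And>x y. x \<in> S \<Longrightarrow> (x, y) \<in> parcs G \<Longrightarrow> y \<in> S"
    and v: "v \<in> pverts G"
  shows "v \<in> S"
proof -
  have "u \<rightarrow>\<^sup>*\<^bsub>with_proj G\<^esub> v"
    using sc u v by (auto simp: strongly_connected_def)
  then have "(u, v) \<in> rtrancl_on (pverts G) (parcs G)"
    by (simp add: reachable_def)
  then show ?thesis
    by (induction rule: rtrancl_on_induct) (use u closed in auto)
qed

text \<open>Maximum principle: where \<open>h\<close> is maximal, the average over the out-neighbors
  is maximal too, which forces every out-neighbor to attain the maximum. The harmonic equation has
  its denominator cleared, so it also makes sense at a vertex without out-neighbors.\<close>

lemma harmonic_constant:
  fixes h :: "'a \<Rightarrow> real"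
  assumes G: "pair_digraph G" and sc: "strongly_connected (with_proj G)"
    and pos: "\<forall>e\<in>parcs G. w e > 0"
    and harmonic: "\<And>u. u \<in> pverts G \<Longrightarrow>
      (\<Sum>v\<in>out_neighbors G u. w (u, v) * h v) = (\<Sum>v\<in>out_neighbors G u. w (u, v)) * h u"
  obtains c where "\<And>v. v \<in> pverts G \<Longrightarrow> h v = c"
proof
  interpret pair_digraph G by fact
  let ?M = "Max (h ` pverts G)"
  have ne: "pverts G \<noteq> {}"
    using sc by (simp add: strongly_connected_def)
  have le: "h v \<le> ?M" if "v \<in> pverts G" for v
    using that pair_finite_verts by simp
  obtain u where u: "u \<in> pverts G" "h u = ?M"
    using Max_in[of "h ` pverts G"] ne pair_finite_verts
    by (metis (no_types, lifting) finite_imageI image_iff image_is_empty)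
  show "h v = ?M" if "v \<in> pverts G" for v
  proof -
    have "v \<in> {v \<in> pverts G. h v = ?M}"
    proof (rule strongly_connected_closed_set[OF sc u(1) _ _ that])
      fix x y
      assume x: "x \<in> {v \<in> pverts G. h v = ?M}" and xy: "(x, y) \<in> parcs G"
      let ?N = "out_neighbors G x"
      \<comment> \<open>The harmonic equation at \<open>x\<close>, where \<open>h x\<close> is the
        maximum. The terms are nonnegative, so each of them vanishes.\<close>
      have "(\<Sum>v\<in>?N. w (x, v) * (?M - h v)) = 0"
        using harmonic[of x] x by (simp add: right_diff_distrib sum_subtractf sum_distrib_right)
      moreover have "w (x, v) * (?M - h v) \<ge> 0" if "v \<in> ?N" for v
      proof (rule mult_nonneg_nonneg)
        have xv: "(x, v) \<in> parcs G"
          using that by (simp add: out_neighbors_def)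
        then show "w (x, v) \<ge> 0"
          using pos less_imp_le by blast
        show "?M - h v \<ge> 0"
          using le[OF in_arcsD2[OF xv]] by simp
      qed
      ultimately have "\<forall>v\<in>?N. w (x, v) * (?M - h v) = 0"
        by (subst (asm) sum_nonneg_eq_0_iff[OF finite_out_neighbors[OF G]])
      then have "w (x, y) * (?M - h y) = 0"
        using xy by (simp add: out_neighbors_def)
      then show "y \<in> {v \<in> pverts G. h v = ?M}"
        using pos xy in_arcsD2[OF xy] by fastforce
    qed (use u in simp)
    then show ?thesis
      by simp
  qed
qed

text \<open>Otherwise a functional \<open>g\<close> would vanish on all color directions but not on
  \<open>b - a\<close>. Its restriction to the vertices is harmonic, hence constant, and then
  \<open>g\<close> is constant on blends.\<close>

lemma chromonic_directions:
  assumes G: "pair_digraph G" and sc: "strongly_connected (with_proj G)"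
    and pos: "\<forall>e\<in>parcs G. w e > 0"
    and R: "color_equivalence (pverts G) R" and chrom: "chromonic G w R"
    and a: "a \<in> blends (pverts G)" and b: "b \<in> blends (pverts G)"
  shows "b - a \<in> color_directions R"
proof (rule ccontr)
  interpret pair_digraph G by fact
  assume "b - a \<notin> color_directions R"
  moreover have "fun_real.vs1.subspace (color_directions R)"
    using subspace_color_directions[OF R] color_equivalence_refl[OF R a] by blast
  ultimately obtain g where g: "Vector_Spaces.linear fun_scale (*) g"
      and g0: "\<And>x. x \<in> color_directions R \<Longrightarrow> g x = 0" and g1: "g (b - a) = (1 :: real)"
    using fun_real.linear_functional_vanishing_on_subspace by blast
  interpret g: Vector_Spaces.linear fun_scale "(*) :: real \<Rightarrow> real \<Rightarrow> real" g
    by fact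
  define h where "h v = g (vertex_blend v)" for v
  have g_sum: "g (\<lambda>x. \<Sum>v\<in>A. k v * vertex_blend v x) = (\<Sum>v\<in>A. k v * h v)"
    for k :: "'a \<Rightarrow> real" and A
  proof -
    have "(\<lambda>x. \<Sum>v\<in>A. k v * vertex_blend v x) = (\<Sum>v\<in>A. fun_scale (k v) (vertex_blend v))"
      by (auto simp: sum_fun_apply fun_scale_def)
    then show ?thesis
      by (simp add: g.sum g.scale h_def)
  qed
  \<comment> \<open>The chromonic condition makes \<open>out_blend G w u - vertex_blend u\<close> a
    color direction with factor 1; that \<open>g\<close> kills it is the harmonic equation at
    \<open>u\<close>.\<close>
  have "(\<Sum>v\<in>out_neighbors G u. w (u, v) * h v) = (\<Sum>v\<in>out_neighbors G u. w (u, v)) * h u"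
    if u: "u \<in> pverts G" for u
  proof (cases "out_neighbors G u = {}")
    case False
    let ?W = "\<Sum>v\<in>out_neighbors G u. w (u, v)"
    have W: "?W > 0"
      using False pos finite_out_neighbors[OF G] by (intro sum_pos) (auto simp: out_neighbors_def)
    have "(vertex_blend u, out_blend G w u) \<in> R"
      using chrom u False by (simp add: chromonic_def)
    then have "out_blend G w u - vertex_blend u \<in> color_directions R"
      by (intro color_directionsI[of 1]) auto
    then have "g (out_blend G w u) = h u"
      using g0 g.diff h_def by fastforce
    moreover have "out_blend G w u =
        fun_scale (1 / ?W) (\<lambda>x. \<Sum>v\<in>out_neighbors G u. w (u, v) * vertex_blend v x)"
      by (simp add: out_blend_def fun_scale_def)
    ultimately have "(\<Sum>v\<in>out_neighbors G u. w (u, v) * h v) / ?W = h u"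
      using g_sum by (simp add: g.scale)
    then show ?thesis
      using W by (simp add: divide_eq_eq mult.commute)
  qed simp
  then obtain c where c: "\<And>v. v \<in> pverts G \<Longrightarrow> h v = c"
    using harmonic_constant[OF G sc pos, of h] by blast
  \<comment> \<open>A blend is a convex combination of vertices, all of which have the value
    \<open>c\<close>.\<close>
  have g_const: "g x = c" if x: "x \<in> blends (pverts G)" for x
  proof -
    have "x = (\<lambda>y. \<Sum>v\<in>pverts G. x v * vertex_blend v y)"
    proof
      fix y
      have "(\<Sum>v\<in>pverts G. x v * vertex_blend v y) = (\<Sum>v\<in>pverts G. if y = v then x v else 0)"
        by (intro sum.cong) (auto simp: vertex_blend_def)
      then show "x y = (\<Sum>v\<in>pverts G. x v * vertex_blend v y)"
        using x pair_finite_verts by (simp add: blends_def)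
    qed
    then have "g x = (\<Sum>v\<in>pverts G. x v * h v)"
      using g_sum by metis
    also have "\<dots> = (\<Sum>v\<in>pverts G. x v) * c"
      using c by (simp add: sum_distrib_right)
    finally show ?thesis
      using x by (simp add: blends_def)
  qed
  show False
    using g1 g.diff[of b a] g_const a b by simp
qed

section \<open>Equivalence of vertices to blends with full support\<close>

lemma out_blend_pos:
  assumes G: "pair_digraph G" and pos: "\<forall>e\<in>parcs G. w e > 0" and uv: "(u, v) \<in> parcs G"
  shows "out_blend G w u v > 0"
proof -
  have wpos: "w (u, x) > 0" if "x \<in> out_neighbors G u" for x
    using that pos by (simp add: out_neighbors_def)
  have v: "v \<in> out_neighbors G u"
    using uv by (simp add: out_neighbors_def)
  have "(\<Sum>x\<in>out_neighbors G u. w (u, x)) > 0"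
    using v wpos finite_out_neighbors[OF G] by (intro sum_pos) auto
  moreover have "(\<Sum>x\<in>out_neighbors G u. w (u, x) * vertex_blend x v) > 0"
    using v wpos finite_out_neighbors[OF G]
    by (intro sum_pos2[of _ v]) (auto simp: vertex_blend_def less_imp_le)
  ultimately show ?thesis
    by (simp add: out_blend_def)
qed

text \<open>Exchanging part of a vertex for its out-neighbors carries positive weight along edges to
  any given vertex; averaging the blends so obtained makes all coefficients positive at
  once.\<close>

lemma vertex_equivalent_full_support:
  assumes G: "pair_digraph G" and sc: "strongly_connected (with_proj G)"
    and pos: "\<forall>e\<in>parcs G. w e > 0"
    and R: "color_equivalence (pverts G) R" and chrom: "chromonic G w R"
    and u: "u \<in> pverts G"
  obtains a where "(vertex_blend u, a) \<in> R" "\<And>v. v \<in> pverts G \<Longrightarrow> a v > 0"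
proof -
  interpret pair_digraph G by fact
  let ?V = "pverts G"
  have fin: "finite ?V"
    by (rule pair_finite_verts)
  have u_blend: "vertex_blend u \<in> blends ?V"
    using vertex_blend_in_blends[OF fin u] .
  have refl_u: "(vertex_blend u, vertex_blend u) \<in> R"
    using color_equivalence_refl[OF R u_blend] .
  have reach: "v \<in> {v. \<exists>a. (vertex_blend u, a) \<in> R \<and> a v > 0}" if v: "v \<in> ?V" for v
  proof (rule strongly_connected_closed_set[OF sc u _ _ v])
    show "u \<in> {v. \<exists>a. (vertex_blend u, a) \<in> R \<and> a v > 0}"
      using refl_u by (auto simp: vertex_blend_def intro!: exI[of _ "vertex_blend u"])
  next
    fix x y
    assume "x \<in> {v. \<exists>a. (vertex_blend u, a) \<in> R \<and> a v > 0}" and xy: "(x, y) \<in> parcs G"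
    then obtain a where ua: "(vertex_blend u, a) \<in> R" and ax: "a x > 0"
      by blast
    have a: "a \<in> blends ?V"
      using color_equivalence_blends[OF R ua] by blast
    \<comment> \<open>The portion of \<open>x\<close> in \<open>a\<close> to be exchanged for
      \<open>out_blend G w x\<close>; the cap 1/2 keeps it below 1.\<close>
    define s where "s = min (a x) (1 / 2)"
    have s: "0 < s" "s < 1"
      using ax by (auto simp: s_def)
    have x: "x \<in> ?V"
      using in_arcsD1[OF xy] .
    have "s * vertex_blend x v \<le> a v" if "v \<in> ?V" for v
      using a that by (auto simp: blends_def vertex_blend_def s_def)
    then obtain z where z: "z \<in> blends ?V" "a = mix s (vertex_blend x) z"
      using split_off_blend[OF fin a vertex_blend_in_blends[OF fin x]] s
      by (metis less_imp_le)
    have "(vertex_blend x, out_blend G w x) \<in> R"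
      using chrom x xy by (auto simp: chromonic_def out_neighbors_def)
    then have "(mix s (vertex_blend x) z, mix s (out_blend G w x) z) \<in> R"
      using color_equivalence_mix[OF R _ color_equivalence_refl[OF R z(1)]] s by simp
    then have "(vertex_blend u, mix s (out_blend G w x) z) \<in> R"
      using color_equivalence_trans[OF R ua] z(2) by simp
    moreover have "mix s (out_blend G w x) z y > 0"
      unfolding mix_def using s z(1) in_arcsD2[OF xy] out_blend_pos[OF G pos xy]
      by (intro add_pos_nonneg) (auto simp: blends_def)
    ultimately show "y \<in> {v. \<exists>a. (vertex_blend u, a) \<in> R \<and> a v > 0}"
      by blast
  qed
  \<comment> \<open>Induction on the set of vertices that already carry positive weight: the
    midpoint of two blends is positive wherever one of them is.\<close>
  have "\<exists>a. (vertex_blend u, a) \<in> R \<and> (\<forall>v\<in>F. a v > 0)" if "finite F" "F \<subseteq> ?V" for F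
    using that
  proof (induction F)
    case empty
    then show ?case
      using refl_u by auto
  next
    case (insert v F)
    then obtain a where a: "(vertex_blend u, a) \<in> R" "\<forall>v\<in>F. a v > 0"
      by blast
    obtain b where b: "(vertex_blend u, b) \<in> R" "b v > 0"
      using reach insert.prems by blast
    have nonneg: "a v \<ge> 0" "b v \<ge> 0" if "v \<in> ?V" for v
      using color_equivalence_blends[OF R a(1)] color_equivalence_blends[OF R b(1)] that
      by (auto simp: blends_def)
    \<comment> \<open>The midpoint of \<open>vertex_blend u\<close> with itself is
      \<open>vertex_blend u\<close>.\<close>
    have "(vertex_blend u, mix (1 / 2) a b) \<in> R"
      using color_equivalence_mix[OF R a(1) b(1), of "1 / 2"] by (simp add: mix_self)
    moreover have "mix (1 / 2) a b x > 0" if "x \<in> insert v F" for x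
    proof -
      have "a x > 0 \<or> b x > 0" "a x \<ge> 0" "b x \<ge> 0"
        using that a(2) b(2) insert.prems nonneg[of x] by auto
      then show ?thesis
        by (auto simp: mix_def)
    qed
    ultimately show ?case
      by blast
  qed
  from this[OF fin] show ?thesis
    using that by blast
qed

theorem theorem1p1:
  fixes G :: "'a pair_pre_digraph"
    and w :: "'a \<times> 'a \<Rightarrow> real"
    and R :: "('a \<Rightarrow> real) rel"
  assumes "pair_digraph G"
    and "strongly_connected (with_proj G)"
    and "\<forall>e\<in>parcs G. w e > 0"
    and "color_equivalence (pverts G) R"
    and "chromonic G w R"
  shows "\<forall>u\<in>pverts G. \<forall>v\<in>pverts G.
           color R (vertex_blend u) = color R (vertex_blend v) \<and>
           (vertex_blend u, vertex_blend v) \<in> R"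
proof (intro ballI)
  interpret pair_digraph G by fact
  fix u v
  assume u: "u \<in> pverts G" and v: "v \<in> pverts G"
  note R = \<open>color_equivalence (pverts G) R\<close>
  obtain a where a: "(vertex_blend u, a) \<in> R" "\<And>x. x \<in> pverts G \<Longrightarrow> a x > 0"
    using vertex_equivalent_full_support[OF assms u] by blast
  obtain b where b: "(vertex_blend v, b) \<in> R" "\<And>x. x \<in> pverts G \<Longrightarrow> b x > 0"
    using vertex_equivalent_full_support[OF assms v] by blast
  have ab: "a \<in> blends (pverts G)" "b \<in> blends (pverts G)"
    using color_equivalence_blends[OF R] a(1) b(1) by blast+
  \<comment> \<open>Both blends have full support and their difference is a color direction, so the
    walk along the segment joins them.\<close>
  have "(a, b) \<in> R"
    using full_support_equivalent[OF R pair_finite_verts _ ab(1) a(2) ab(2) b(2)]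
      chromonic_directions[OF assms ab] u by blast
  then have "(vertex_blend u, vertex_blend v) \<in> R"
    using a(1) b(1) color_equivalence_trans[OF R] color_equivalence_sym[OF R] by blast
  then show "color R (vertex_blend u) = color R (vertex_blend v) \<and>
      (vertex_blend u, vertex_blend v) \<in> R"
    unfolding color_def using equiv_class_eq[OF color_equivalence_equiv[OF R]] by blast
qed

end
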